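(* For all $\tau\in\mathbb{C}-\mathbb{R}$ the identities \[ \theta_0(z+1,\tau)=\theta_0(z,\tau),\qquad \theta_0(z+\tau,\tau)=-e^{-2\pi iz}\theta_0(z,\tau),\qquad \theta_0(\tau-z,\tau)=\theta_0(z,\tau) \] hold. The identities \[ \Gamma(z,\tau,\sigma)=\Gamma(z,\sigma,\tau),\qquad \Gamma(z+1,\tau,\sigma)=\Gamma(z,\tau,\sigma), \] \[ \Gamma(z+\sigma,\tau,\sigma)=\theta_0(z,\tau)\Gamma(z,\tau,\sigma),\qquad \Gamma(z+\tau,\tau,\sigma)=\theta_0(z,\sigma)\Gamma(z,\tau,\sigma), \] \[ \Gamma((\tau+\sigma)/2,\tau,\sigma)=1, \] \[ \Gamma(z,\tau,\sigma)\Gamma(\sigma-z,\tau,\sigma)=\frac1{\theta_0(z,\sigma)},\qquad \Gamma(z,\tau,\sigma)\Gamma(\tau-z,\tau,\sigma)=\frac1{\theta_0(z,\tau)}, \] \[ \Gamma(z,\tau,\sigma)\Gamma(\tau+\sigma-z,\tau,\sigma)=1 \] hold for all $z\in\mathbb{C}$, $\tau,\sigma\in\mathbb{C}-\mathbb{R}$ whenever both sides are defined. The summation formula \[ \Gamma(z,\tau,\sigma)=\exp\left(-\frac i2\sum_{j=1}^\infty\frac{\sin(\pi j(2z-\tau-\sigma))}{j\sin(\pi j\tau)\sin(\pi j\sigma)}\right) \] is valid for all $z\in\mathbb{C}$, $\tau,\sigma\in\mathbb{C}-\mathbb{R}$ such that the sum converges absolutely.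
   Context: For $|q|,|r|<1$ put $(x;q)=\prod_{j\ge0}(1-xq^j)$ and $(x;q,r)=\prod_{j,k\ge0}(1-xq^jr^k)$. These are extended to meromorphic functions on $|q|\neq1$, resp. $|q|\neq1\neq|r|$, by \[ (x;q^{-1})=\frac1{(qx;q)},\qquad (x;q^{-1},r)=\frac1{(qx;q,r)},\qquad (x;q,r^{-1})=\frac1{(rx;q,r)}. \] For $\tau,\sigma\in\mathbb{C}-\mathbb{R}$, with $x=e^{2\pi iz}$, $q=e^{2\pi i\tau}$, $r=e^{2\pi i\sigma}$, \[ \theta_0(z,\tau)=(x;q)(q/x;q),\qquad \Gamma(z,\tau,\sigma)=\frac{(qr/x;q,r)}{(x;q,r)}. \] *)

theory Defs
  imports "HOL-Complex_Analysis.Complex_Analysis"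
begin

definition qpoch_prod :: "complex \<Rightarrow> complex \<Rightarrow> complex" where
  "qpoch_prod x q = (\<Prod>j. 1 - x * q ^ j)"

definition qrpoch_prod :: "complex \<Rightarrow> complex \<Rightarrow> complex \<Rightarrow> complex" where
  "qrpoch_prod x q r = (\<Prod>j. \<Prod>k. 1 - x * q ^ j * r ^ k)"

text \<open>
  The functions \<open>(x; q)\<close> and \<open>(x; q, r)\<close> on \<open>|q| \<noteq> 1 \<noteq> |r|\<close>. The values outside the unit disk are
  those forced by the extension rules \<open>(x; 1/q) = 1 / (q x; q)\<close> etc., which are derived below; for two
  parameters outside the disk the rule applies twice. The values for \<open>|q| = 1\<close>, \<open>|r| = 1\<close>,
  \<open>q = 0\<close> or \<open>r = 0\<close> are never used. At a pole the value is \<open>1 / 0 = 0\<close>.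
\<close>

definition qpoch :: "complex \<Rightarrow> complex \<Rightarrow> complex" where
  "qpoch x q = (if norm q < 1 then qpoch_prod x q else 1 / qpoch_prod (x / q) (1 / q))"

definition qrpoch :: "complex \<Rightarrow> complex \<Rightarrow> complex \<Rightarrow> complex" where
  "qrpoch x q r =
    (if norm q < 1 \<and> norm r < 1 then qrpoch_prod x q r
     else if norm r < 1 then 1 / qrpoch_prod (x / q) (1 / q) r
     else if norm q < 1 then 1 / qrpoch_prod (x / r) q (1 / r)
     else qrpoch_prod (x / (q * r)) (1 / q) (1 / r))"

lemma qpoch_inverse:
  assumes "q \<noteq> 0" "norm q \<noteq> 1"
  shows "qpoch x (1 / q) = 1 / qpoch (q * x) q"
  using assms by (auto simp: qpoch_def norm_divide field_simps)

lemma qrpoch_inverse_left: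
  assumes "q \<noteq> 0" "norm q \<noteq> 1" "r \<noteq> 0" "norm r \<noteq> 1"
  shows "qrpoch x (1 / q) r = 1 / qrpoch (q * x) q r"
  using assms by (auto simp: qrpoch_def norm_divide field_simps)

lemma qrpoch_inverse_right:
  assumes "q \<noteq> 0" "norm q \<noteq> 1" "r \<noteq> 0" "norm r \<noteq> 1"
  shows "qrpoch x q (1 / r) = 1 / qrpoch (r * x) q r"
  using assms by (auto simp: qrpoch_def norm_divide field_simps)

definition expi :: "complex \<Rightarrow> complex" where
  "expi z = exp (2 * of_real pi * \<i> * z)"

definition theta0 :: "complex \<Rightarrow> complex \<Rightarrow> complex" where
  "theta0 z \<tau> = (let x = expi z; q = expi \<tau> in qpoch x q * qpoch (q / x) q)"

text \<open>
  For nonreal \<open>\<tau>\<close> and \<open>\<sigma>\<close>, numerator and denominator of the elliptic Gamma function have no common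
  zeros or poles in \<open>z\<close>. Hence, also where the denominator has a pole (and so the value 0 here), the
  quotient below is the value of the meromorphic function, except at the poles of the latter.
\<close>

definition ell_Gamma :: "complex \<Rightarrow> complex \<Rightarrow> complex \<Rightarrow> complex" where
  "ell_Gamma z \<tau> \<sigma> =
    (let x = expi z; q = expi \<tau>; r = expi \<sigma> in qrpoch (q * r / x) q r / qrpoch x q r)"

text \<open>
  A meromorphic function is defined at a point if it has no pole there; this notion does not depend on
  the values that the HOL function takes at its poles.
\<close>

definition defined_at :: "(complex \<Rightarrow> complex) \<Rightarrow> complex \<Rightarrow> bool" where
  "defined_at f z \<longleftrightarrow> \<not> is_pole f z"

definition theta0_defined :: "complex \<Rightarrow> complex \<Rightarrow> bool" where
  "theta0_defined z \<tau> \<longleftrightarrow> defined_at (\<lambda>w. theta0 w \<tau>) z"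

definition inverse_theta0_defined :: "complex \<Rightarrow> complex \<Rightarrow> bool" where
  "inverse_theta0_defined z \<tau> \<longleftrightarrow> defined_at (\<lambda>w. 1 / theta0 w \<tau>) z"

definition ell_Gamma_defined :: "complex \<Rightarrow> complex \<Rightarrow> complex \<Rightarrow> bool" where
  "ell_Gamma_defined z \<tau> \<sigma> \<longleftrightarrow> defined_at (\<lambda>w. ell_Gamma w \<tau> \<sigma>) z"

definition ell_Gamma_summand :: "complex \<Rightarrow> complex \<Rightarrow> complex \<Rightarrow> nat \<Rightarrow> complex" where
  "ell_Gamma_summand z \<tau> \<sigma> j =
     sin (of_real pi * of_nat j * (2 * z - \<tau> - \<sigma>)) /
     (of_nat j * sin (of_real pi * of_nat j * \<tau>) * sin (of_real pi * of_nat j * \<sigma>))"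

end

theory Submission
  imports Defs
begin

text \<open>
  In the unit disk, a function \<open>f\<close> with \<open>f x = exp (- (\<Sum>j. c j * x ^ Suc j))\<close> and \<open>c\<close> bounded gives a
  product \<open>F x = (\<Prod>k. f (x * q ^ k))\<close> of the same kind: dividing \<open>c j\<close> by \<open>1 - q ^ Suc j\<close> makes the
  exponents telescope along \<open>x, x q, x q\<^sup>2, \<dots>\<close> (\<open>log_coeffs_qprod\<close>). The recursion
  \<open>F x = f x * F (x q)\<close> then carries \<open>F\<close> to the whole plane, where it is entire if \<open>f\<close> is. Starting
  from \<open>1 - x\<close>, one such step gives \<open>(x; q)\<close> and two give \<open>(x; q, r)\<close>. The latter has two recursions,
  \<open>(x; q, r) = (x; r) (x q; q, r) = (x; q) (x r; q, r)\<close>, and is symmetric in \<open>q\<close> and \<open>r\<close>.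

  For \<open>\<tau>\<close> and \<open>\<sigma>\<close> in the upper half-plane, all functional equations follow from these recursions
  by cancelling factors of the denominators, which is legitimate because a zero of the denominator
  of the elliptic Gamma function is a pole of that function (\<open>ell_Gamma_poles\<close>): the numerator does not
  vanish there. In the summation formula, absolute convergence forces \<open>0 < Im z < Im (\<tau> + \<sigma>)\<close>, since
  the terms are otherwise bounded below by a multiple of the harmonic series; both double products
  are then in the range of the exponential formula.

  The other half-planes reduce to this one by \<open>\<Gamma>(z, \<tau>, -\<sigma>) = \<Gamma>(\<tau> - z, \<tau>, \<sigma>)\<close>,
  \<open>\<Gamma>(z, -\<tau>, -\<sigma>) = \<Gamma>(z + \<tau> + \<sigma>, \<tau>, \<sigma>)\<close> and \<open>\<theta>\<^sub>0(z, -\<tau>) = 1 / \<theta>\<^sub>0(-z, \<tau>)\<close>; the terms of the sum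
  transform in the same way as \<open>\<Gamma>\<close>. These hold at every point with the convention \<open>1 / 0 = 0\<close>.
\<close>

section \<open>Functions given by a power series for their logarithm\<close>

text \<open>
  On the unit disk, \<open>f\<close> is the exponential of the power series with coefficient \<open>- c j\<close> at \<open>x ^ (j + 1)\<close>
  and without constant term. The coefficients are required to be bounded, which is a simple
  condition for convergence in the disk that passes to infinite products. Outside the disk \<open>f\<close> is
  arbitrary.
\<close>

definition log_coeffs :: "(nat \<Rightarrow> complex) \<Rightarrow> (complex \<Rightarrow> complex) \<Rightarrow> bool" where
  "log_coeffs c f \<longleftrightarrow> (\<exists>C. \<forall>j. norm (c j) \<le> C) \<and>
     (\<forall>x. norm x < 1 \<longrightarrow> f x = exp (- (\<Sum>j. c j * x ^ Suc j)))"

lemma summable_bounded_powser: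
  fixes c :: "nat \<Rightarrow> complex"
  assumes "\<And>j. norm (c j) \<le> C" "norm x < 1"
  shows "summable (\<lambda>j. norm (c j * x ^ j))"
proof (rule summable_comparison_test')
  show "summable (\<lambda>j. C * norm x ^ j)"
    using assms(2) by (intro summable_mult summable_geometric) auto
  show "norm (norm (c j * x ^ j)) \<le> C * norm x ^ j" if "j \<ge> 0" for j
    using assms(1)[of j] by (auto simp: norm_mult norm_power intro!: mult_right_mono)
qed

lemma log_coeffs_summable:
  assumes "log_coeffs c f" "norm x < 1"
  shows "summable (\<lambda>j. c j * x ^ Suc j)"
proof -
  obtain C where "\<And>j. norm (c j) \<le> C" using assms(1) by (auto simp: log_coeffs_def)
  from summable_norm_cancel[OF summable_bounded_powser[OF this assms(2)]]
  have "summable (\<lambda>j. x * (c j * x ^ j))" by (rule summable_mult)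
  then show ?thesis by (simp add: mult_ac)
qed

lemma log_coeffs_holomorphic:
  assumes "log_coeffs c f"
  shows "(\<lambda>x. \<Sum>j. c j * x ^ Suc j) holomorphic_on ball 0 1" and "f holomorphic_on ball 0 1"
proof -
  obtain C where C: "\<And>j. norm (c j) \<le> C" using assms(1) by (auto simp: log_coeffs_def)
  have sm: "summable (\<lambda>j. c j * x ^ j)" if "norm x < 1" for x
    by (rule summable_norm_cancel[OF summable_bounded_powser[OF C that]])
  have "(\<lambda>x. \<Sum>j. c j * x ^ j) field_differentiable at x" if "norm x < 1" for x
    using termdiffs_strong'[of 1 c x, OF sm that] by (auto simp: field_differentiable_def)
  then have "(\<lambda>x. \<Sum>j. c j * x ^ j) holomorphic_on ball 0 1"
    by (auto simp: holomorphic_on_def intro: field_differentiable_at_within)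
  then have *: "(\<lambda>x. x * (\<Sum>j. c j * x ^ j)) holomorphic_on ball 0 1"
    by (intro holomorphic_intros)
  show L: "(\<lambda>x. \<Sum>j. c j * x ^ Suc j) holomorphic_on ball 0 1"
    by (rule holomorphic_transform[OF *])
      (use sm in \<open>auto simp: suminf_mult[symmetric] mult_ac\<close>)
  have "(\<lambda>x. exp (- (\<Sum>j. c j * x ^ Suc j))) holomorphic_on ball 0 1"
    using L by (intro holomorphic_intros)
  then show "f holomorphic_on ball 0 1"
    by (rule holomorphic_transform) (use assms in \<open>auto simp: log_coeffs_def\<close>)
qed

lemma log_coeffs_nonzero: "log_coeffs c f \<Longrightarrow> norm x < 1 \<Longrightarrow> f x \<noteq> 0"
  by (simp add: log_coeffs_def)

lemma log_coeffs_one_minus: "log_coeffs (\<lambda>j. 1 / of_nat (Suc j)) (\<lambda>x. 1 - x)"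
  unfolding log_coeffs_def
proof (intro conjI allI impI exI[of _ 1])
  show "norm (1 / of_nat (Suc j) :: complex) \<le> 1" for j
    by (simp add: norm_divide del: of_nat_Suc)
next
  fix x :: complex assume x: "norm x < 1"
  have "(\<lambda>n. - (x ^ n) / of_nat n) sums ln (1 - x)"
    using Ln_series'[of "-x"] x by simp
  then have "(\<lambda>n. - (x ^ Suc n) / of_nat (Suc n)) sums ln (1 - x)"
    by (subst sums_Suc_iff) simp
  from sums_minus[OF this] have "(\<Sum>n. 1 / of_nat (Suc n) * x ^ Suc n) = - ln (1 - x)"
    by (simp add: sums_iff)
  moreover have "1 - x \<noteq> 0" using x by auto
  ultimately show "1 - x = exp (- (\<Sum>j. 1 / of_nat (Suc j) * x ^ Suc j))"
    by (simp add: exp_Ln)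
qed

section \<open>Infinite products along a geometric progression\<close>

text \<open>The product of the values of \<open>f\<close> along the progression \<open>x, x q, x q\<^sup>2, \<dots>\<close>, as a function of \<open>x\<close>.\<close>

definition qprod :: "(complex \<Rightarrow> complex) \<Rightarrow> complex \<Rightarrow> complex \<Rightarrow> complex" where
  "qprod f q x = (\<Prod>k. f (x * q ^ k))"

lemma ex_power_shrink:
  fixes x q :: complex
  assumes "norm q < 1"
  shows "\<exists>n. norm (x * q ^ n) < 1"
proof -
  have "(\<lambda>n. x * q ^ n) \<longlonglongrightarrow> x * 0"
    using assms by (intro tendsto_intros LIMSEQ_power_zero)
  then have "(\<lambda>n. norm (x * q ^ n)) \<longlonglongrightarrow> 0" by (intro tendsto_norm_zero) simp
  from order_tendstoD(2)[OF this, of 1] show ?thesis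
    by (auto simp: eventually_sequentially)
qed

lemma
  fixes q :: complex
  assumes "norm q < 1"
  shows norm_one_minus_power_ge: "norm (1 - q ^ Suc j) \<ge> 1 - norm q"
    and one_minus_power_nonzero: "1 - q ^ Suc j \<noteq> 0"
proof -
  have "norm q ^ Suc j \<le> norm q" using assms
    by (metis less_eq_real_def norm_ge_zero power_decreasing power_one_right Suc_le_mono le0 One_nat_def)
  then show *: "norm (1 - q ^ Suc j) \<ge> 1 - norm q"
    using norm_triangle_ineq2[of 1 "q ^ Suc j"] by (simp only: norm_power norm_one)
  then show "1 - q ^ Suc j \<noteq> 0" using assms by force
qed

lemma qprod_unit_disk:
  assumes f: "log_coeffs c f" and q: "norm q < 1" and x: "norm x < 1"
  shows "(\<lambda>k. f (x * q ^ k)) has_prod exp (- (\<Sum>j. c j / (1 - q ^ Suc j) * x ^ Suc j))"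
    and "\<exists>C. \<forall>j. norm (c j / (1 - q ^ Suc j)) \<le> C"
proof -
  let ?d = "\<lambda>j. c j / (1 - q ^ Suc j)"
  obtain C where C: "\<And>j. norm (c j) \<le> C" using f by (auto simp: log_coeffs_def)
  have "C \<ge> 0" using C[of 0] norm_ge_zero order_trans by blast
  have "norm (?d j) \<le> C / (1 - norm q)" for j
    unfolding norm_divide using C[of j] norm_one_minus_power_ge[OF q, of j] q \<open>C \<ge> 0\<close>
    by (intro frac_le) auto
  then show bd: "\<exists>C. \<forall>j. norm (?d j) \<le> C" by blast
  define L where "L y = (\<Sum>j. ?d j * y ^ Suc j)" for y
  have d: "log_coeffs ?d (\<lambda>y. exp (- L y))"
    using bd by (auto simp: log_coeffs_def L_def)
  have xq: "norm (x * q ^ k) < 1" for k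
  proof -
    have "norm (x * q ^ k) \<le> norm x * 1"
      unfolding norm_mult norm_power using q by (intro mult_left_mono power_le_one) auto
    then show ?thesis using x by simp
  qed
  \<comment> \<open>The coefficients of \<open>L\<close> are chosen such that \<open>L y - L (y q)\<close> is the series of \<open>f\<close>.\<close>
  have step: "f y = exp (L (y * q) - L y)" if y: "norm y < 1" for y
  proof -
    have yq: "norm (y * q) < 1"
      using norm_mult_less[OF y q] by simp
    have "L y - L (y * q) = (\<Sum>j. ?d j * y ^ Suc j - ?d j * (y * q) ^ Suc j)"
      unfolding L_def by (rule suminf_diff[OF log_coeffs_summable[OF d y] log_coeffs_summable[OF d yq]])
    also have "\<dots> = (\<Sum>j. c j * y ^ Suc j)"
    proof (rule suminf_cong)
      fix j
      have gen: "d * a - d * (a * b) = d * (1 - b) * a" for a b d :: complex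
        by (simp add: algebra_simps)
      have "?d j * y ^ Suc j - ?d j * (y * q) ^ Suc j = ?d j * (1 - q ^ Suc j) * y ^ Suc j"
        unfolding power_mult_distrib using gen .
      also have "\<dots> = c j * y ^ Suc j" using one_minus_power_nonzero[OF q, of j] by simp
      finally show "?d j * y ^ Suc j - ?d j * (y * q) ^ Suc j = c j * y ^ Suc j" .
    qed
    finally have "L (y * q) - L y = - (\<Sum>j. c j * y ^ Suc j)" by (simp add: algebra_simps)
    then show ?thesis using f y by (simp add: log_coeffs_def)
  qed
  have part: "(\<Prod>k\<le>n. f (x * q ^ k)) = exp (L (x * q ^ Suc n) - L x)" for n
  proof (induction n)
    case 0
    then show ?case using step[OF x] by simp
  next
    case (Suc n)
    then show ?case using step[OF xq[of "Suc n"]] by (simp add: exp_add[symmetric] mult_ac)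
  qed
  have "isCont L 0"
    using log_coeffs_holomorphic(1)[OF d] unfolding L_def[symmetric]
    by (auto dest!: holomorphic_on_imp_continuous_on simp: continuous_on_eq_continuous_at)
  moreover have "(\<lambda>n. x * q ^ Suc n) \<longlonglongrightarrow> x * 0"
    using q by (intro tendsto_intros LIMSEQ_Suc LIMSEQ_power_zero)
  ultimately have "(\<lambda>n. L (x * q ^ Suc n)) \<longlonglongrightarrow> L 0"
    using isCont_tendsto_compose by fastforce
  then have "(\<lambda>n. exp (L (x * q ^ Suc n) - L x)) \<longlonglongrightarrow> exp (L 0 - L x)"
    by (intro tendsto_intros)
  then have "raw_has_prod (\<lambda>k. f (x * q ^ k)) 0 (exp (- L x))"
    unfolding raw_has_prod_def using part by (simp add: L_def)
  then show "(\<lambda>k. f (x * q ^ k)) has_prod exp (- (\<Sum>j. ?d j * x ^ Suc j))"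
    by (simp add: has_prod_def L_def)
qed

lemma log_coeffs_qprod:
  assumes "log_coeffs c f" "norm q < 1"
  shows "log_coeffs (\<lambda>j. c j / (1 - q ^ Suc j)) (qprod f q)"
  unfolding log_coeffs_def qprod_def
  using qprod_unit_disk(2)[OF assms, of 0]
    has_prod_unique[OF qprod_unit_disk(1)[OF assms]] by auto

lemma qprod_convergent:
  assumes "log_coeffs c f" "norm q < 1"
  shows "convergent_prod (\<lambda>k. f (x * q ^ k))"
proof -
  obtain n where "norm (x * q ^ n) < 1" using ex_power_shrink[OF assms(2)] by blast
  then have "convergent_prod (\<lambda>k. f (x * q ^ n * q ^ k))"
    using qprod_unit_disk(1)[OF assms] has_prod_iff by blast
  then have "convergent_prod (\<lambda>k. f (x * q ^ (k + n)))"
    by (simp add: power_add mult_ac)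
  then show ?thesis by (rule convergent_prod_offset)
qed

lemma qprod_rec:
  assumes "log_coeffs c f" "norm q < 1"
  shows "qprod f q x = f x * qprod f q (x * q)"
proof -
  have "(\<lambda>n. \<Prod>k\<le>Suc n. f (x * q ^ k)) \<longlonglongrightarrow> qprod f q x"
    unfolding qprod_def using convergent_prod_LIMSEQ[OF qprod_convergent[OF assms]]
    by (rule LIMSEQ_Suc)
  moreover have "(\<lambda>n. \<Prod>k\<le>Suc n. f (x * q ^ k)) = (\<lambda>n. f x * (\<Prod>k\<le>n. f (x * q * q ^ k)))"
    by (subst prod.atMost_Suc_shift) (simp add: mult_ac)
  moreover have "(\<lambda>n. f x * (\<Prod>k\<le>n. f (x * q * q ^ k))) \<longlonglongrightarrow> f x * qprod f q (x * q)"
    unfolding qprod_def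
    by (intro tendsto_intros convergent_prod_LIMSEQ[OF qprod_convergent[OF assms]])
  ultimately show ?thesis using LIMSEQ_unique by metis
qed

text \<open>
  By \<open>qprod_rec\<close>, holomorphy on the unit disk extends to the disks \<open>norm (x * q ^ n) < 1\<close>, which exhaust
  the plane. (For \<open>q = 0\<close> the set is already the whole plane for \<open>n = 1\<close>.)
\<close>

lemma qprod_entire:
  assumes "log_coeffs c f" "norm q < 1" "f holomorphic_on UNIV"
  shows "qprod f q holomorphic_on UNIV"
proof -
  have fh: "f holomorphic_on A" for A using assms(3) holomorphic_on_subset by blast
  have h: "qprod f q holomorphic_on {x. norm (x * q ^ n) < 1}" for n
  proof (induction n)
    case 0
    then show ?case using log_coeffs_holomorphic(2)[OF log_coeffs_qprod[OF assms(1,2)]]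
      by (simp add: ball_def)
  next
    case (Suc n)
    have "(\<lambda>x. f x * (qprod f q \<circ> (\<lambda>x. x * q)) x) holomorphic_on {x. norm (x * q ^ Suc n) < 1}"
      by (intro holomorphic_intros fh holomorphic_on_compose_gen[OF _ Suc]) (auto simp: mult_ac)
    then show ?case
      by (rule holomorphic_transform) (simp add: qprod_rec[OF assms(1,2), symmetric])
  qed
  have o: "open {x. norm (x * q ^ n) < 1}" for n
    by (intro open_Collect_less continuous_intros)
  have "qprod f q holomorphic_on (\<Union>n. {x. norm (x * q ^ n) < 1})"
    by (rule holomorphic_on_UN_open) (use h o in auto)
  moreover have "(\<Union>n. {x. norm (x * q ^ n) < 1}) = UNIV"
  proof (intro equalityI subset_UNIV subsetI)
    fix x :: complex
    obtain n where "norm (x * q ^ n) < 1" using ex_power_shrink[OF assms(2)] by blast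
    then show "x \<in> (\<Union>n. {x. norm (x * q ^ n) < 1})" by auto
  qed
  ultimately show ?thesis by simp
qed

section \<open>The products \<open>(x; q)\<close> and \<open>(x; q, r)\<close> for parameters in the unit disk\<close>

lemma qpoch_prod_eq_qprod: "(\<lambda>x. qpoch_prod x q) = qprod (\<lambda>x. 1 - x) q"
  by (simp add: fun_eq_iff qpoch_prod_def qprod_def)

lemma qrpoch_prod_eq_qprod: "(\<lambda>x. qrpoch_prod x q r) = qprod (\<lambda>x. qpoch_prod x r) q"
  by (simp add: fun_eq_iff qrpoch_prod_def qpoch_prod_def qprod_def)

lemma log_coeffs_qpoch_prod:
  assumes "norm q < 1"
  shows "log_coeffs (\<lambda>j. 1 / of_nat (Suc j) / (1 - q ^ Suc j)) (\<lambda>x. qpoch_prod x q)"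
  unfolding qpoch_prod_eq_qprod by (rule log_coeffs_qprod[OF log_coeffs_one_minus assms])

lemma log_coeffs_qrpoch_prod:
  assumes "norm q < 1" "norm r < 1"
  shows "log_coeffs (\<lambda>j. 1 / of_nat (Suc j) / (1 - r ^ Suc j) / (1 - q ^ Suc j))
           (\<lambda>x. qrpoch_prod x q r)"
  unfolding qrpoch_prod_eq_qprod by (rule log_coeffs_qprod[OF log_coeffs_qpoch_prod]) fact+

lemma qpoch_prod_rec:
  assumes "norm q < 1"
  shows "qpoch_prod x q = (1 - x) * qpoch_prod (x * q) q"
  using qprod_rec[OF log_coeffs_one_minus assms, of x]
  by (simp flip: qpoch_prod_eq_qprod)

lemma qrpoch_prod_rec_left:
  assumes "norm q < 1" "norm r < 1"
  shows "qrpoch_prod x q r = qpoch_prod x r * qrpoch_prod (x * q) q r"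
  using qprod_rec[OF log_coeffs_qpoch_prod assms(1), of r x] assms(2)
  by (simp flip: qrpoch_prod_eq_qprod)

text \<open>The other recursion is obtained by splitting off the factor \<open>k = 0\<close> of every inner product.\<close>

lemma qrpoch_prod_rec_right:
  assumes "norm q < 1" "norm r < 1"
  shows "qrpoch_prod x q r = qpoch_prod x q * qrpoch_prod (x * r) q r"
proof -
  have 1: "convergent_prod (\<lambda>k. 1 - x * q ^ k)"
    by (rule qprod_convergent[OF log_coeffs_one_minus assms(1)])
  have 2: "convergent_prod (\<lambda>k. qpoch_prod (x * r * q ^ k) r)"
    by (rule qprod_convergent[OF log_coeffs_qpoch_prod assms(1)]) fact
  have "qrpoch_prod x q r = (\<Prod>k. qpoch_prod (x * q ^ k) r)"
    by (simp add: qrpoch_prod_def qpoch_prod_def)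
  also have "\<dots> = (\<Prod>k. (1 - x * q ^ k) * qpoch_prod (x * r * q ^ k) r)"
    by (subst qpoch_prod_rec[OF assms(2)]) (simp add: mult_ac)
  also have "\<dots> = qpoch_prod x q * qrpoch_prod (x * r) q r"
    using prodinf_mult[OF 1 2] by (simp add: qrpoch_prod_def qpoch_prod_def)
  finally show ?thesis .
qed

text \<open>
  In the unit disk, the logarithmic coefficients are symmetric in \<open>q\<close> and \<open>r\<close>; the two recursions
  extend this to the plane without interchanging the order of the products.
\<close>

lemma qrpoch_prod_commute:
  assumes q: "norm q < 1" and r: "norm r < 1"
  shows "qrpoch_prod x q r = qrpoch_prod x r q"
proof -
  have "qrpoch_prod x q r = qrpoch_prod x r q" if "norm (x * r ^ n) < 1" for n x
    using that
  proof (induction n arbitrary: x)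
    case 0
    then show ?case
      using log_coeffs_qrpoch_prod[OF q r] log_coeffs_qrpoch_prod[OF r q]
      by (simp add: log_coeffs_def mult_ac)
  next
    case (Suc n)
    then have "qrpoch_prod (x * r) q r = qrpoch_prod (x * r) r q" by (simp add: mult_ac)
    then show ?case
      using qrpoch_prod_rec_right[OF q r, of x] qrpoch_prod_rec_left[OF r q, of x] by simp
  qed
  then show ?thesis using ex_power_shrink[OF r] by blast
qed

lemma qpoch_prod_entire:
  assumes "norm q < 1"
  shows "(\<lambda>x. qpoch_prod x q) holomorphic_on UNIV"
  unfolding qpoch_prod_eq_qprod
  by (rule qprod_entire[OF log_coeffs_one_minus assms]) (intro holomorphic_intros)

lemma qrpoch_prod_entire:
  assumes "norm q < 1" "norm r < 1"
  shows "(\<lambda>x. qrpoch_prod x q r) holomorphic_on UNIV"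
  unfolding qrpoch_prod_eq_qprod
  by (rule qprod_entire[OF log_coeffs_qpoch_prod]) (use assms qpoch_prod_entire in auto)

section \<open>Additive notation\<close>

lemma expi_nonzero [simp]: "expi z \<noteq> 0"
  by (simp add: expi_def)

lemma expi_add: "expi (z + w) = expi z * expi w"
  by (simp add: expi_def exp_add ring_distribs)

lemma expi_diff: "expi (z - w) = expi z / expi w"
  by (simp add: expi_def exp_diff ring_distribs)

lemma expi_minus: "expi (- z) = 1 / expi z"
  by (simp add: expi_def exp_minus field_simps)

lemma expi_1 [simp]: "expi 1 = 1"
  by (simp add: expi_def exp_eq_1)

lemma norm_expi_less_1_iff: "norm (expi z) < 1 \<longleftrightarrow> Im z > 0"
  by (simp add: expi_def zero_less_mult_iff)

lemma expi_entire: "expi holomorphic_on A"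
  unfolding expi_def by (intro holomorphic_intros)

text \<open>
  The products \<open>(x; q)\<close> and \<open>(x; q, r)\<close> with \<open>x = expi z\<close>, \<open>q = expi \<tau>\<close>, \<open>r = expi \<sigma>\<close>, so that multiplying
  \<open>x\<close> by \<open>q\<close> is adding \<open>\<tau>\<close> to \<open>z\<close>. Both are meant for \<open>\<tau>\<close> and \<open>\<sigma>\<close> in the upper half-plane only.
\<close>

definition qpoch_expi :: "complex \<Rightarrow> complex \<Rightarrow> complex" where
  "qpoch_expi \<tau> z = qpoch_prod (expi z) (expi \<tau>)"

definition qrpoch_expi :: "complex \<Rightarrow> complex \<Rightarrow> complex \<Rightarrow> complex" where
  "qrpoch_expi \<tau> \<sigma> z = qrpoch_prod (expi z) (expi \<tau>) (expi \<sigma>)"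

lemma qpoch_expi_rec: "Im \<tau> > 0 \<Longrightarrow> qpoch_expi \<tau> z = (1 - expi z) * qpoch_expi \<tau> (z + \<tau>)"
  using qpoch_prod_rec[of "expi \<tau>" "expi z"]
  by (simp only: qpoch_expi_def norm_expi_less_1_iff expi_add)

lemma qpoch_expi_entire: "Im \<tau> > 0 \<Longrightarrow> qpoch_expi \<tau> holomorphic_on UNIV"
  using holomorphic_on_compose[OF expi_entire, of "\<lambda>x. qpoch_prod x (expi \<tau>)" UNIV]
    qpoch_prod_entire[of "expi \<tau>"]
  by (simp add: qpoch_expi_def[abs_def] o_def norm_expi_less_1_iff holomorphic_on_subset)

lemma qpoch_expi_nonzero:
  assumes "Im \<tau> > 0" "Im z > 0"
  shows "qpoch_expi \<tau> z \<noteq> 0"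
  unfolding qpoch_expi_def
  by (rule log_coeffs_nonzero[OF log_coeffs_qpoch_prod]) (use assms in \<open>simp_all add: norm_expi_less_1_iff\<close>)

context
  fixes \<tau> \<sigma> :: complex
  assumes \<tau>: "Im \<tau> > 0" and \<sigma>: "Im \<sigma> > 0"
begin

lemma qrpoch_expi_rec_left: "qrpoch_expi \<tau> \<sigma> z = qpoch_expi \<sigma> z * qrpoch_expi \<tau> \<sigma> (z + \<tau>)"
  and qrpoch_expi_rec_right: "qrpoch_expi \<tau> \<sigma> z = qpoch_expi \<tau> z * qrpoch_expi \<tau> \<sigma> (z + \<sigma>)"
  and qrpoch_expi_commute: "qrpoch_expi \<tau> \<sigma> z = qrpoch_expi \<sigma> \<tau> z"
  using \<tau> \<sigma> qrpoch_prod_rec_left[of "expi \<tau>" "expi \<sigma>" "expi z"]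
    qrpoch_prod_rec_right[of "expi \<tau>" "expi \<sigma>" "expi z"]
    qrpoch_prod_commute[of "expi \<tau>" "expi \<sigma>" "expi z"]
  by (simp_all only: qpoch_expi_def qrpoch_expi_def norm_expi_less_1_iff expi_add)

lemma qrpoch_expi_entire: "qrpoch_expi \<tau> \<sigma> holomorphic_on UNIV"
  using holomorphic_on_compose[OF expi_entire, of "\<lambda>x. qrpoch_prod x (expi \<tau>) (expi \<sigma>)" UNIV]
    qrpoch_prod_entire[of "expi \<tau>" "expi \<sigma>"] \<tau> \<sigma>
  by (simp add: qrpoch_expi_def[abs_def] o_def norm_expi_less_1_iff holomorphic_on_subset)

lemma qrpoch_expi_nonzero:
  assumes "Im z > 0"
  shows "qrpoch_expi \<tau> \<sigma> z \<noteq> 0"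
  unfolding qrpoch_expi_def using assms \<tau> \<sigma>
  by (intro log_coeffs_nonzero[OF log_coeffs_qrpoch_prod]) (simp_all add: norm_expi_less_1_iff)

lemma ell_Gamma_eq:
  "ell_Gamma z \<tau> \<sigma> = qrpoch_expi \<tau> \<sigma> (\<tau> + \<sigma> - z) / qrpoch_expi \<tau> \<sigma> z"
  using \<tau> \<sigma> unfolding ell_Gamma_def qrpoch_def qrpoch_expi_def Let_def
  by (simp add: norm_expi_less_1_iff expi_add expi_diff)

text \<open>
  Parameters in the lower half-plane reduce to the upper one by a change of \<open>z\<close>. These identities
  hold at all points, poles included, since \<open>(1 / a) / (1 / b) = b / a\<close> also for \<open>a = 0\<close> or \<open>b = 0\<close>.
\<close>

lemma ell_Gamma_minus_right: "ell_Gamma z \<tau> (- \<sigma>) = ell_Gamma (\<tau> - z) \<tau> \<sigma>"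
  using \<tau> \<sigma> unfolding ell_Gamma_eq unfolding ell_Gamma_def qrpoch_def qrpoch_expi_def Let_def
  by (simp add: norm_expi_less_1_iff expi_add expi_diff) (simp add: expi_minus mult_ac)

lemma ell_Gamma_minus_left: "ell_Gamma z (- \<tau>) \<sigma> = ell_Gamma (\<sigma> - z) \<tau> \<sigma>"
  using \<tau> \<sigma> unfolding ell_Gamma_eq unfolding ell_Gamma_def qrpoch_def qrpoch_expi_def Let_def
  by (simp add: norm_expi_less_1_iff expi_add expi_diff) (simp add: expi_minus mult_ac)

lemma ell_Gamma_minus_both: "ell_Gamma z (- \<tau>) (- \<sigma>) = ell_Gamma (z + \<tau> + \<sigma>) \<tau> \<sigma>"
  using \<tau> \<sigma> unfolding ell_Gamma_eq unfolding ell_Gamma_def qrpoch_def qrpoch_expi_def Let_def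
  by (simp add: norm_expi_less_1_iff expi_add expi_diff) (simp add: expi_minus mult_ac)

end

lemma theta0_eq: "Im \<tau> > 0 \<Longrightarrow> theta0 z \<tau> = qpoch_expi \<tau> z * qpoch_expi \<tau> (\<tau> - z)"
  unfolding theta0_def qpoch_def qpoch_expi_def Let_def
  by (simp add: norm_expi_less_1_iff expi_diff)

lemma theta0_minus: "Im \<tau> > 0 \<Longrightarrow> theta0 z (- \<tau>) = 1 / theta0 (- z) \<tau>"
  unfolding theta0_eq unfolding theta0_def qpoch_def qpoch_expi_def Let_def
  by (simp add: norm_expi_less_1_iff expi_diff) (simp add: expi_minus expi_add mult_ac)

section \<open>The theta function\<close>

lemma is_pole_quotient_entire:
  fixes f g :: "complex \<Rightarrow> complex"
  assumes "f holomorphic_on UNIV" "g holomorphic_on UNIV" "f z \<noteq> 0" "g z = 0" "g w \<noteq> 0"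
  shows "is_pole (\<lambda>z. f z / g z) z"
proof (rule is_pole_divide)
  have cont: "isCont h z" if "h holomorphic_on UNIV" for h :: "complex \<Rightarrow> complex"
    using holomorphic_on_imp_continuous_on[OF that] by (simp add: continuous_on_eq_continuous_at)
  show "isCont f z" by (rule cont) fact
  have "\<forall>\<^sub>F w in at z. g w \<noteq> 0"
    using non_zero_neighbour_alt[OF assms(2), of z w] assms(5) by auto
  moreover have "(g \<longlongrightarrow> 0) (at z)"
    using cont[OF assms(2)] assms(4) by (simp add: isCont_def)
  ultimately show "filterlim g (at 0) (at z)" by (simp add: filterlim_at)
qed fact

lemma theta0_shift_1: "theta0 (z + 1) \<tau> = theta0 z \<tau>"
  by (simp add: theta0_def expi_add)

lemma theta0_reflect: "theta0 (\<tau> - z) \<tau> = theta0 z \<tau>"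
  by (simp add: theta0_def expi_diff Let_def mult.commute)

lemma theta0_shift_upper:
  assumes "Im \<tau> > 0"
  shows "theta0 (z + \<tau>) \<tau> = - expi (- z) * theta0 z \<tau>"
proof -
  have "qpoch_expi \<tau> z = (1 - expi z) * qpoch_expi \<tau> (z + \<tau>)"
    and "qpoch_expi \<tau> (- z) = (1 - expi (- z)) * qpoch_expi \<tau> (\<tau> - z)"
    using qpoch_expi_rec[OF assms, of z] qpoch_expi_rec[OF assms, of "- z"] by simp_all
  moreover have "1 - expi (- z) = - expi (- z) * (1 - expi z)"
    by (simp add: expi_minus field_simps)
  ultimately show ?thesis by (simp add: theta0_eq[OF assms])
qed

lemma theta0_shift:
  assumes "\<tau> \<notin> \<real>"
  shows "theta0 (z + \<tau>) \<tau> = - expi (- z) * theta0 z \<tau>"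
proof (cases "Im \<tau> > 0")
  case True
  then show ?thesis by (rule theta0_shift_upper)
next
  case False
  then have im: "Im (- \<tau>) > 0" using assms by (simp add: complex_is_Real_iff)
  have "theta0 (z + \<tau>) \<tau> = 1 / theta0 (- z - \<tau>) (- \<tau>)"
    using theta0_minus[OF im, of "z + \<tau>"] by simp
  also have "\<dots> = - expi (- z) * (1 / theta0 (- z) (- \<tau>))"
    using theta0_shift_upper[OF im, of "- z"] by (simp add: expi_minus)
  also have "1 / theta0 (- z) (- \<tau>) = theta0 z \<tau>"
    using theta0_minus[OF im, of z] by simp
  finally show ?thesis .
qed

text \<open>For a parameter in the lower half-plane, the theta function is the inverse of an entire one.\<close>

lemma theta0_defined_minusD:
  assumes \<tau>: "Im \<tau> > 0" and "theta0_defined z (- \<tau>)"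
  shows "theta0 (- z) \<tau> \<noteq> 0"
proof
  assume 0: "theta0 (- z) \<tau> = 0"
  have entire: "(\<lambda>w. qpoch_expi \<tau> (h w)) holomorphic_on UNIV" if "h holomorphic_on UNIV" for h
    using holomorphic_on_compose[OF that holomorphic_on_subset[OF qpoch_expi_entire[OF \<tau>]]]
    by (simp add: o_def)
  have "is_pole (\<lambda>w. 1 / theta0 (- w) \<tau>) z"
  proof (rule is_pole_quotient_entire[where f = "\<lambda>_. 1" and g = "\<lambda>w. theta0 (- w) \<tau>"])
    show "(\<lambda>w. theta0 (- w) \<tau>) holomorphic_on UNIV"
      unfolding theta0_eq[OF \<tau>] by (intro holomorphic_intros entire)
    \<comment> \<open>At \<open>\<tau> / 2\<close> both arguments of the product, \<open>\<tau> / 2\<close> and \<open>\<tau> - \<tau> / 2\<close>, are in the upper half-plane.\<close>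
    show "theta0 (- (- \<tau> / 2)) \<tau> \<noteq> 0"
      using \<tau> by (simp add: theta0_eq qpoch_expi_nonzero)
  qed (use 0 in auto)
  then show False
    using assms by (simp add: theta0_defined_def defined_at_def theta0_minus)
qed

section \<open>Poles and functional equations for parameters in the upper half-plane\<close>

context
  fixes \<tau> \<sigma> :: complex
  assumes \<tau>: "Im \<tau> > 0" and \<sigma>: "Im \<sigma> > 0"
begin

text \<open>
  The change of variable \<open>h\<close> allows the use for all signs of \<open>Im \<tau>\<close> and \<open>Im \<sigma>\<close>. The point \<open>w\<close> with
  \<open>Im (h w) > 0\<close> shows that the denominator is not identically zero, hence has isolated zeros.
\<close>

lemma ell_Gamma_poles:
  assumes h: "h holomorphic_on UNIV" "Im (h w) > 0" and 0: "qrpoch_expi \<tau> \<sigma> (h z) = 0"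
  shows "is_pole (\<lambda>w. ell_Gamma (h w) \<tau> \<sigma>) z"
  unfolding ell_Gamma_eq[OF \<tau> \<sigma>]
proof (rule is_pole_quotient_entire[where f = "\<lambda>w. qrpoch_expi \<tau> \<sigma> (\<tau> + \<sigma> - h w)"
      and g = "\<lambda>w. qrpoch_expi \<tau> \<sigma> (h w)"])
  have entire: "(\<lambda>w. qrpoch_expi \<tau> \<sigma> (h w)) holomorphic_on UNIV" if "h holomorphic_on UNIV" for h
    using holomorphic_on_compose[OF that holomorphic_on_subset[OF qrpoch_expi_entire[OF \<tau> \<sigma>]]]
    by (simp add: o_def)
  show "(\<lambda>w. qrpoch_expi \<tau> \<sigma> (h w)) holomorphic_on UNIV"
    by (rule entire) fact
  show "(\<lambda>w. qrpoch_expi \<tau> \<sigma> (\<tau> + \<sigma> - h w)) holomorphic_on UNIV"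
    by (rule entire) (intro holomorphic_intros h)
  \<comment> \<open>A zero of the denominator is in the closed lower half-plane, so the numerator is evaluated in
    the open upper half-plane.\<close>
  have "\<not> Im (h z) > 0"
    using 0 qrpoch_expi_nonzero[OF \<tau> \<sigma>] by blast
  then show "qrpoch_expi \<tau> \<sigma> (\<tau> + \<sigma> - h z) \<noteq> 0"
    using \<tau> \<sigma> by (intro qrpoch_expi_nonzero) auto
  show "qrpoch_expi \<tau> \<sigma> (h w) \<noteq> 0"
    by (rule qrpoch_expi_nonzero[OF \<tau> \<sigma> h(2)])
qed (rule 0)

text \<open>The definedness hypotheses are used only in this form, one for each pair of half-planes.\<close>

lemma ell_Gamma_definedD:
  "ell_Gamma_defined z \<tau> \<sigma> \<Longrightarrow> qrpoch_expi \<tau> \<sigma> z \<noteq> 0"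
  "ell_Gamma_defined z \<tau> (- \<sigma>) \<Longrightarrow> qrpoch_expi \<tau> \<sigma> (\<tau> - z) \<noteq> 0"
  "ell_Gamma_defined z (- \<tau>) \<sigma> \<Longrightarrow> qrpoch_expi \<tau> \<sigma> (\<sigma> - z) \<noteq> 0"
  "ell_Gamma_defined z (- \<tau>) (- \<sigma>) \<Longrightarrow> qrpoch_expi \<tau> \<sigma> (z + \<tau> + \<sigma>) \<noteq> 0"
proof -
  note defs = ell_Gamma_defined_def defined_at_def ell_Gamma_minus_right[OF \<tau> \<sigma>]
    ell_Gamma_minus_left[OF \<tau> \<sigma>] ell_Gamma_minus_both[OF \<tau> \<sigma>]
  show "ell_Gamma_defined z \<tau> \<sigma> \<Longrightarrow> qrpoch_expi \<tau> \<sigma> z \<noteq> 0"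
    using ell_Gamma_poles[of "\<lambda>z. z" \<tau> z] \<tau> by (auto simp: defs)
  show "ell_Gamma_defined z \<tau> (- \<sigma>) \<Longrightarrow> qrpoch_expi \<tau> \<sigma> (\<tau> - z) \<noteq> 0"
    using ell_Gamma_poles[of "\<lambda>z. \<tau> - z" 0 z] \<tau>
    by (auto simp: defs holomorphic_on_diff)
  show "ell_Gamma_defined z (- \<tau>) \<sigma> \<Longrightarrow> qrpoch_expi \<tau> \<sigma> (\<sigma> - z) \<noteq> 0"
    using ell_Gamma_poles[of "\<lambda>z. \<sigma> - z" 0 z] \<sigma>
    by (auto simp: defs holomorphic_on_diff)
  show "ell_Gamma_defined z (- \<tau>) (- \<sigma>) \<Longrightarrow> qrpoch_expi \<tau> \<sigma> (z + \<tau> + \<sigma>) \<noteq> 0"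
    using ell_Gamma_poles[of "\<lambda>z. z + \<tau> + \<sigma>" 0 z] \<tau> \<sigma>
    by (auto simp: defs holomorphic_on_add)
qed

lemma ell_Gamma_shift_upper:
  assumes "qrpoch_expi \<tau> \<sigma> z \<noteq> 0"
  shows "ell_Gamma (z + \<sigma>) \<tau> \<sigma> = theta0 z \<tau> * ell_Gamma z \<tau> \<sigma>"
proof -
  have "qrpoch_expi \<tau> \<sigma> z = qpoch_expi \<tau> z * qrpoch_expi \<tau> \<sigma> (z + \<sigma>)"
    "qrpoch_expi \<tau> \<sigma> (\<tau> - z) = qpoch_expi \<tau> (\<tau> - z) * qrpoch_expi \<tau> \<sigma> (\<tau> + \<sigma> - z)"
    using qrpoch_expi_rec_right[OF \<tau> \<sigma>, of z] qrpoch_expi_rec_right[OF \<tau> \<sigma>, of "\<tau> - z"]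
    by (simp_all add: algebra_simps)
  then show ?thesis
    using assms by (simp add: ell_Gamma_eq[OF \<tau> \<sigma>] theta0_eq[OF \<tau>])
qed

lemma ell_Gamma_reflect_sum_upper:
  assumes "qrpoch_expi \<tau> \<sigma> z \<noteq> 0" "qrpoch_expi \<tau> \<sigma> (\<tau> + \<sigma> - z) \<noteq> 0"
  shows "ell_Gamma z \<tau> \<sigma> * ell_Gamma (\<tau> + \<sigma> - z) \<tau> \<sigma> = 1"
  using assms by (simp add: ell_Gamma_eq[OF \<tau> \<sigma>])

lemma ell_Gamma_reflect_upper:
  assumes "qrpoch_expi \<tau> \<sigma> z \<noteq> 0" "qrpoch_expi \<tau> \<sigma> (\<sigma> - z) \<noteq> 0"
  shows "ell_Gamma z \<tau> \<sigma> * ell_Gamma (\<sigma> - z) \<tau> \<sigma> = 1 / theta0 z \<sigma>"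
proof -
  have "qrpoch_expi \<tau> \<sigma> z = qpoch_expi \<sigma> z * qrpoch_expi \<tau> \<sigma> (z + \<tau>)"
    "qrpoch_expi \<tau> \<sigma> (\<sigma> - z) = qpoch_expi \<sigma> (\<sigma> - z) * qrpoch_expi \<tau> \<sigma> (\<tau> + \<sigma> - z)"
    using qrpoch_expi_rec_left[OF \<tau> \<sigma>, of z] qrpoch_expi_rec_left[OF \<tau> \<sigma>, of "\<sigma> - z"]
    by (simp_all add: algebra_simps)
  then show ?thesis
    using assms by (simp add: ell_Gamma_eq[OF \<tau> \<sigma>] theta0_eq[OF \<sigma>] add_ac)
qed

text \<open>The form of the preceding reflection formula that is needed for \<open>- \<sigma>\<close> in place of \<open>\<sigma>\<close>.\<close>

lemma ell_Gamma_reflect_lower: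
  assumes "qrpoch_expi \<tau> \<sigma> (\<tau> - z) \<noteq> 0" "qrpoch_expi \<tau> \<sigma> (z + \<tau> + \<sigma>) \<noteq> 0"
  shows "ell_Gamma (\<tau> - z) \<tau> \<sigma> * ell_Gamma (z + \<tau> + \<sigma>) \<tau> \<sigma> = theta0 (- z) \<sigma>"
proof -
  have "qrpoch_expi \<tau> \<sigma> (- z) = qpoch_expi \<sigma> (- z) * qrpoch_expi \<tau> \<sigma> (\<tau> - z)"
    "qrpoch_expi \<tau> \<sigma> (z + \<sigma>) = qpoch_expi \<sigma> (z + \<sigma>) * qrpoch_expi \<tau> \<sigma> (z + \<tau> + \<sigma>)"
    using qrpoch_expi_rec_left[OF \<tau> \<sigma>, of "- z"] qrpoch_expi_rec_left[OF \<tau> \<sigma>, of "z + \<sigma>"]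
    by (simp_all add: algebra_simps)
  then show ?thesis
    using assms by (simp add: ell_Gamma_eq[OF \<tau> \<sigma>] theta0_eq[OF \<sigma>] add_ac)
qed

end

section \<open>Functional equations for all nonreal parameters\<close>

lemma nonreal_pair_cases:
  assumes "\<tau> \<notin> \<real>" "\<sigma> \<notin> \<real>"
  obtains "Im \<tau> > 0" "Im \<sigma> > 0"
  | \<sigma>' where "Im \<tau> > 0" "Im \<sigma>' > 0" "\<sigma> = - \<sigma>'"
  | \<tau>' where "Im \<tau>' > 0" "Im \<sigma> > 0" "\<tau> = - \<tau>'"
  | \<tau>' \<sigma>' where "Im \<tau>' > 0" "Im \<sigma>' > 0" "\<tau> = - \<tau>'" "\<sigma> = - \<sigma>'"
proof -
  have "Im \<tau> > 0 \<or> Im (- \<tau>) > 0" "Im \<sigma> > 0 \<or> Im (- \<sigma>) > 0"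
    using assms by (auto simp: complex_is_Real_iff)
  then show ?thesis using that by (metis minus_minus)
qed

lemmas ell_Gamma_minus = ell_Gamma_minus_right ell_Gamma_minus_left ell_Gamma_minus_both

lemma ell_Gamma_commute:
  assumes "\<tau> \<notin> \<real>" "\<sigma> \<notin> \<real>"
  shows "ell_Gamma z \<tau> \<sigma> = ell_Gamma z \<sigma> \<tau>"
proof -
  have *: "ell_Gamma z \<tau> \<sigma> = ell_Gamma z \<sigma> \<tau>" if "Im \<tau> > 0" "Im \<sigma> > 0" for z \<tau> \<sigma>
    using qrpoch_expi_commute[OF that] that by (simp add: ell_Gamma_eq add_ac)
  from assms show ?thesis
    by (cases rule: nonreal_pair_cases) (simp_all add: ell_Gamma_minus * add_ac)
qed

text \<open>
  For \<open>Im \<tau> < 0\<close> the theta factor moves to the other side of \<open>ell_Gamma_shift_upper\<close>. This is where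
  the theta function must have no pole: its inverse has to be cancelled.
\<close>

lemma ell_Gamma_shift:
  assumes "\<tau> \<notin> \<real>" "\<sigma> \<notin> \<real>"
    "ell_Gamma_defined (z + \<sigma>) \<tau> \<sigma>" "theta0_defined z \<tau>" "ell_Gamma_defined z \<tau> \<sigma>"
  shows "ell_Gamma (z + \<sigma>) \<tau> \<sigma> = theta0 z \<tau> * ell_Gamma z \<tau> \<sigma>"
  using assms(1,2)
proof (cases rule: nonreal_pair_cases)
  case 1
  then show ?thesis using assms by (intro ell_Gamma_shift_upper ell_Gamma_definedD)
next
  case (2 \<sigma>')
  with assms(5) have "qrpoch_expi \<tau> \<sigma>' (\<tau> - z) \<noteq> 0" by (simp add: ell_Gamma_definedD)
  from ell_Gamma_shift_upper[OF 2(1,2) this] show ?thesis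
    using 2 theta0_reflect[of \<tau> z] by (simp add: ell_Gamma_minus algebra_simps)
next
  case (3 \<tau>')
  with assms(3) have "qrpoch_expi \<tau>' \<sigma> (- z) \<noteq> 0"
    using ell_Gamma_definedD(3)[OF 3(1,2), of "z + \<sigma>"] by simp
  moreover from 3 assms(4) have "theta0 (- z) \<tau>' \<noteq> 0" by (simp add: theta0_defined_minusD)
  ultimately show ?thesis
    using 3 ell_Gamma_shift_upper[OF 3(1,2), of "- z"]
    by (simp add: ell_Gamma_minus theta0_minus)
next
  case (4 \<tau>' \<sigma>')
  with assms(3) have "qrpoch_expi \<tau>' \<sigma>' (z + \<tau>') \<noteq> 0"
    using ell_Gamma_definedD(4)[OF 4(1,2), of "z - \<sigma>'"] by simp
  moreover from 4 assms(4) have "theta0 (- z) \<tau>' \<noteq> 0" by (simp add: theta0_defined_minusD)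
  moreover have "theta0 (z + \<tau>') \<tau>' = theta0 (- z) \<tau>'"
    using theta0_reflect[of \<tau>' "- z"] by (simp add: add_ac)
  ultimately show ?thesis
    using 4 ell_Gamma_shift_upper[OF 4(1,2), of "z + \<tau>'"]
    by (simp add: ell_Gamma_minus theta0_minus)
qed

lemma ell_Gamma_reflect:
  assumes "\<tau> \<notin> \<real>" "\<sigma> \<notin> \<real>" "ell_Gamma_defined z \<tau> \<sigma>" "ell_Gamma_defined (\<sigma> - z) \<tau> \<sigma>"
  shows "ell_Gamma z \<tau> \<sigma> * ell_Gamma (\<sigma> - z) \<tau> \<sigma> = 1 / theta0 z \<sigma>"
  using assms(1,2)
proof (cases rule: nonreal_pair_cases)
  case 1
  then show ?thesis using assms by (intro ell_Gamma_reflect_upper ell_Gamma_definedD)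
next
  case (2 \<sigma>')
  have "\<tau> - (- \<sigma>' - z) = z + \<tau> + \<sigma>'" by simp
  then show ?thesis
    using 2 assms(3,4) ell_Gamma_definedD(2)[OF 2(1,2)] ell_Gamma_reflect_lower[OF 2(1,2), of z]
    by (metis (no_types, lifting) ell_Gamma_minus_right theta0_minus div_by_1 divide_divide_eq_right mult_1)
next
  case (3 \<tau>')
  then have "qrpoch_expi \<tau>' \<sigma> (\<sigma> - z) \<noteq> 0" "qrpoch_expi \<tau>' \<sigma> z \<noteq> 0"
    using assms(3,4) ell_Gamma_definedD(3)[OF 3(1,2), of z] ell_Gamma_definedD(3)[OF 3(1,2), of "\<sigma> - z"]
    by simp_all
  then show ?thesis
    using ell_Gamma_reflect_upper[OF 3(1,2), of z] 3 by (simp add: ell_Gamma_minus mult.commute)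
next
  case (4 \<tau>' \<sigma>')
  have "(- \<sigma>' - z) + \<tau>' + \<sigma>' = \<tau>' - z" by simp
  then show ?thesis
    using 4 assms(3,4) ell_Gamma_definedD(4)[OF 4(1,2)] ell_Gamma_reflect_lower[OF 4(1,2), of z]
    by (metis (no_types, lifting) ell_Gamma_minus_both theta0_minus div_by_1 divide_divide_eq_right mult_1 mult.commute)
qed

lemma ell_Gamma_reflect_sum:
  assumes "\<tau> \<notin> \<real>" "\<sigma> \<notin> \<real>" "ell_Gamma_defined z \<tau> \<sigma>" "ell_Gamma_defined (\<tau> + \<sigma> - z) \<tau> \<sigma>"
  shows "ell_Gamma z \<tau> \<sigma> * ell_Gamma (\<tau> + \<sigma> - z) \<tau> \<sigma> = 1"
  using assms(1,2)
proof (cases rule: nonreal_pair_cases)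
  case 1
  then show ?thesis using assms by (intro ell_Gamma_reflect_sum_upper ell_Gamma_definedD)
next
  case (2 \<sigma>')
  have "\<tau> - (\<tau> + - \<sigma>' - z) = \<tau> + \<sigma>' - (\<tau> - z)" by simp
  then show ?thesis
    using 2 assms(3,4) ell_Gamma_definedD(2)[OF 2(1,2)]
      ell_Gamma_reflect_sum_upper[OF 2(1,2), of "\<tau> - z"]
    by (metis ell_Gamma_minus_right)
next
  case (3 \<tau>')
  have "\<sigma> - (- \<tau>' + \<sigma> - z) = \<tau>' + \<sigma> - (\<sigma> - z)" by simp
  then show ?thesis
    using 3 assms(3,4) ell_Gamma_definedD(3)[OF 3(1,2)]
      ell_Gamma_reflect_sum_upper[OF 3(1,2), of "\<sigma> - z"]
    by (metis ell_Gamma_minus_left)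
next
  case (4 \<tau>' \<sigma>')
  have "(- \<tau>' + - \<sigma>' - z) + \<tau>' + \<sigma>' = \<tau>' + \<sigma>' - (z + \<tau>' + \<sigma>')" by simp
  then show ?thesis
    using 4 assms(3,4) ell_Gamma_definedD(4)[OF 4(1,2)]
      ell_Gamma_reflect_sum_upper[OF 4(1,2), of "z + \<tau>' + \<sigma>'"]
    by (metis ell_Gamma_minus_both)
qed

text \<open>
  At the midpoint numerator and denominator are the same product, which is nonzero: the point is in
  the upper half-plane if \<open>\<tau>\<close> and \<open>\<sigma>\<close> are.
\<close>

lemma ell_Gamma_midpoint:
  assumes "\<tau> \<notin> \<real>" "\<sigma> \<notin> \<real>"
  shows "ell_Gamma ((\<tau> + \<sigma>) / 2) \<tau> \<sigma> = 1"
proof -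
  have *: "ell_Gamma z \<tau> \<sigma> = 1" if "Im \<tau> > 0" "Im \<sigma> > 0" "z = (\<tau> + \<sigma>) / 2" for z \<tau> \<sigma>
  proof -
    have "\<tau> + \<sigma> - z = z" using that(3) by (simp add: field_simps)
    moreover have "qrpoch_expi \<tau> \<sigma> z \<noteq> 0" unfolding that(3) using that(1,2) by (intro qrpoch_expi_nonzero) auto
    ultimately show ?thesis by (simp add: ell_Gamma_eq that(1,2))
  qed
  from assms show ?thesis
    by (cases rule: nonreal_pair_cases)
      (simp_all add: ell_Gamma_minus *, (rule *; simp add: field_simps)+)
qed

section \<open>The summation formula\<close>

lemma sin_eq_exp: "sin w = (exp (\<i> * w) ^ 2 - 1) / (2 * \<i> * exp (\<i> * w))"
  by (simp add: sin_exp_eq exp_minus field_simps power2_eq_square)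

text \<open>
  The identity behind \<open>ell_Gamma_summand_eq\<close>: \<open>a\<close>, \<open>b\<close>, \<open>x\<close> stand for \<open>exp (\<i> * w)\<close> with \<open>w\<close> equal to
  \<open>pi * j * \<tau>\<close>, \<open>pi * j * \<sigma>\<close>, \<open>pi * j * z\<close>, so that their squares are powers of \<open>q\<close>, \<open>r\<close>, \<open>expi z\<close>.
\<close>

lemma sin_quotient_identity:
  fixes a b x n :: complex
  assumes "a \<noteq> 0" "b \<noteq> 0" "x \<noteq> 0" "n \<noteq> 0" "1 - a ^ 2 \<noteq> 0" "1 - b ^ 2 \<noteq> 0"
  shows "((x ^ 2 / (a * b)) ^ 2 - 1) / (2 * \<i> * (x ^ 2 / (a * b))) /
      (n * ((a ^ 2 - 1) / (2 * \<i> * a)) * ((b ^ 2 - 1) / (2 * \<i> * b))) =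
    2 * \<i> * (1 / n / (1 - b ^ 2) / (1 - a ^ 2) * (x ^ 2 - (a * b / x) ^ 2))"
proof -
  define A B where "A = 1 - a ^ 2" and "B = 1 - b ^ 2"
  have eq: "a ^ 2 - 1 = - A" "b ^ 2 - 1 = - B" by (simp_all add: A_def B_def)
  have "A \<noteq> 0" "B \<noteq> 0" using assms(5,6) by (simp_all add: A_def B_def)
  then show ?thesis
    unfolding eq A_def[symmetric] B_def[symmetric]
    using assms(1-4) by (simp add: divide_simps) (simp add: algebra_simps power2_eq_square)
qed

lemma ell_Gamma_summand_eq:
  assumes \<tau>: "Im \<tau> > 0" and \<sigma>: "Im \<sigma> > 0"
  shows "ell_Gamma_summand z \<tau> \<sigma> (Suc j) =
    2 * \<i> * (1 / of_nat (Suc j) / (1 - expi \<sigma> ^ Suc j) / (1 - expi \<tau> ^ Suc j) *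
      (expi z ^ Suc j - expi (\<tau> + \<sigma> - z) ^ Suc j))"
proof -
  define n :: complex where "n = of_nat (Suc j)"
  define E where "E w = exp (\<i> * of_real pi * n * w)" for w
  have n: "n \<noteq> 0" unfolding n_def by (simp del: of_nat_Suc)
  have E0: "E w \<noteq> 0" for w by (simp add: E_def)
  have pow: "expi w ^ Suc j = E w ^ 2" for w
    unfolding expi_def E_def n_def exp_of_nat_mult[symmetric] exp_double[symmetric]
    by (simp only: mult_ac of_nat_numeral)
  have sinE: "sin (of_real pi * n * w) = (E w ^ 2 - 1) / (2 * \<i> * E w)" for w
    unfolding sin_eq_exp E_def by (simp add: mult_ac)
  have num: "E (2 * z - \<tau> - \<sigma>) = E z ^ 2 / (E \<tau> * E \<sigma>)"
    by (simp add: E_def exp_diff exp_add exp_double[symmetric] ring_distribs right_diff_distrib mult_ac)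
  have dual: "E (\<tau> + \<sigma> - z) = E \<tau> * E \<sigma> / E z"
    by (simp add: E_def exp_diff exp_add ring_distribs right_diff_distrib)
  have "1 - E \<tau> ^ 2 \<noteq> 0" "1 - E \<sigma> ^ 2 \<noteq> 0"
    using one_minus_power_nonzero[of "expi \<tau>" j] one_minus_power_nonzero[of "expi \<sigma>" j] \<tau> \<sigma>
    by (simp_all add: pow norm_expi_less_1_iff del: power_Suc)
  then show ?thesis
    unfolding ell_Gamma_summand_def n_def[symmetric] pow sinE num dual
    by (intro sin_quotient_identity n E0)
qed

text \<open>
  For \<open>Im z \<le> 0\<close> the term with \<open>norm (expi z) \<ge> 1\<close> dominates: by \<open>ell_Gamma_summand_eq\<close>, the summand
  with index \<open>j + 1\<close> has norm at least \<open>(1 - norm v) / (2 (j + 1))\<close>, where \<open>v = expi (\<tau> + \<sigma> - z)\<close>.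
\<close>

lemma not_summable_ell_Gamma_summand:
  assumes \<tau>: "Im \<tau> > 0" and \<sigma>: "Im \<sigma> > 0" and z: "Im z \<le> 0"
  shows "\<not> summable (\<lambda>j. norm (ell_Gamma_summand z \<tau> \<sigma> (Suc j)))"
proof
  assume sm: "summable (\<lambda>j. norm (ell_Gamma_summand z \<tau> \<sigma> (Suc j)))"
  define v where "v = expi (\<tau> + \<sigma> - z)"
  define c where "c = (1 - norm v) / 2"
  have v: "norm v < 1" using assms by (simp add: v_def norm_expi_less_1_iff)
  then have c: "c > 0" by (simp add: c_def)
  have bd: "norm (1 - expi w ^ Suc j) \<le> 2" if "Im w > 0" for w j
    using norm_triangle_ineq4[of 1 "expi w ^ Suc j"] power_le_one[of "norm (expi w)" "Suc j"]
      norm_expi_less_1_iff[of w] that by (simp add: norm_power del: power_Suc)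
  have "norm (inverse (real (Suc j)) * c) \<le> norm (ell_Gamma_summand z \<tau> \<sigma> (Suc j))" for j
  proof -
    define s t where "s = norm (1 - expi \<sigma> ^ Suc j)" and "t = norm (1 - expi \<tau> ^ Suc j)"
    have "s > 0" "t > 0"
      using one_minus_power_nonzero[of "expi \<sigma>" j] one_minus_power_nonzero[of "expi \<tau>" j] \<tau> \<sigma>
      unfolding s_def t_def by (simp_all only: norm_expi_less_1_iff zero_less_norm_iff not_False_eq_True)
    have "1 \<le> norm (expi z) ^ Suc j"
      using norm_expi_less_1_iff[of z] z by (intro one_le_power) auto
    moreover have "norm v ^ Suc j \<le> norm v"
      using power_decreasing[of 1 "Suc j" "norm v"] v by simp
    ultimately have "1 - norm v \<le> norm (expi z ^ Suc j - v ^ Suc j)"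
      using norm_triangle_ineq2[of "expi z ^ Suc j" "v ^ Suc j"] by (simp only: norm_power)
    moreover have "s * t \<le> 2 * 2"
      unfolding s_def t_def using bd \<tau> \<sigma> by (intro mult_mono) auto
    ultimately have "(1 - norm v) / 4 \<le> norm (expi z ^ Suc j - v ^ Suc j) / (s * t)"
      using \<open>s > 0\<close> \<open>t > 0\<close> v by (intro frac_le) auto
    moreover have "norm (ell_Gamma_summand z \<tau> \<sigma> (Suc j)) =
        2 * inverse (real (Suc j)) * (norm (expi z ^ Suc j - v ^ Suc j) / (s * t))"
      unfolding ell_Gamma_summand_eq[OF \<tau> \<sigma>] norm_mult norm_divide v_def s_def t_def
      by (simp add: field_simps del: of_nat_Suc power_Suc)
    ultimately show ?thesis using c
      by (simp add: c_def field_simps del: of_nat_Suc)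
  qed
  then have "summable (\<lambda>j. inverse (real (Suc j)) * c)"
    by (intro summable_comparison_test'[OF sm]) auto
  then have "summable (\<lambda>j. inverse (real (Suc j)))"
    using c summable_cmult_iff[of c "\<lambda>j. inverse (real (Suc j))"]
    by (simp add: mult.commute del: of_nat_Suc)
  then show False
    using not_summable_harmonic[where 'a = real] by (simp add: summable_Suc_iff[of "\<lambda>j. inverse (real j)"] del: of_nat_Suc)
qed

lemma ell_Gamma_summand_reflect:
  "ell_Gamma_summand (\<tau> + \<sigma> - z) \<tau> \<sigma> j = - ell_Gamma_summand z \<tau> \<sigma> j"
proof -
  have "of_real pi * of_nat j * (2 * (\<tau> + \<sigma> - z) - \<tau> - \<sigma>) =
      - (of_real pi * of_nat j * (2 * z - \<tau> - \<sigma>))"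
    by (simp add: algebra_simps)
  then show ?thesis by (simp add: ell_Gamma_summand_def del: mult_minus_right)
qed

lemma ell_Gamma_sum_upper:
  assumes \<tau>: "Im \<tau> > 0" and \<sigma>: "Im \<sigma> > 0"
    and sm: "summable (\<lambda>j. norm (ell_Gamma_summand z \<tau> \<sigma> (Suc j)))"
  shows "ell_Gamma z \<tau> \<sigma> = exp (- (\<i> / 2) * (\<Sum>j. ell_Gamma_summand z \<tau> \<sigma> (Suc j)))"
proof -
  define d where "d j = 1 / of_nat (Suc j) / (1 - expi \<sigma> ^ Suc j) / (1 - expi \<tau> ^ Suc j)" for j
  define x y where "x = expi z" and "y = expi (\<tau> + \<sigma> - z)"
  have "Im z > 0"
    using not_summable_ell_Gamma_summand[OF \<tau> \<sigma>, of z] sm by (meson not_le)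
  then have x: "norm x < 1" by (simp add: x_def norm_expi_less_1_iff)
  have "Im (\<tau> + \<sigma> - z) > 0"
    using not_summable_ell_Gamma_summand[OF \<tau> \<sigma>, of "\<tau> + \<sigma> - z"] sm
    by (simp only: ell_Gamma_summand_reflect norm_minus_cancel) (meson not_le)
  then have y: "norm y < 1" unfolding y_def by (simp only: norm_expi_less_1_iff)
  have log: "log_coeffs d (\<lambda>x. qrpoch_prod x (expi \<tau>) (expi \<sigma>))"
    unfolding d_def[abs_def] using \<tau> \<sigma>
    by (intro log_coeffs_qrpoch_prod) (simp_all add: norm_expi_less_1_iff)
  have "(\<lambda>j. 2 * \<i> * (d j * x ^ Suc j - d j * y ^ Suc j)) sums
      (2 * \<i> * ((\<Sum>j. d j * x ^ Suc j) - (\<Sum>j. d j * y ^ Suc j)))"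
    by (intro sums_mult sums_diff summable_sums log_coeffs_summable[OF log] x y)
  then have "(\<Sum>j. ell_Gamma_summand z \<tau> \<sigma> (Suc j)) =
      2 * \<i> * ((\<Sum>j. d j * x ^ Suc j) - (\<Sum>j. d j * y ^ Suc j))"
    unfolding ell_Gamma_summand_eq[OF \<tau> \<sigma>] d_def[symmetric] x_def[symmetric] y_def[symmetric]
    by (simp add: sums_iff right_diff_distrib del: power_Suc)
  then have "- (\<i> / 2) * (\<Sum>j. ell_Gamma_summand z \<tau> \<sigma> (Suc j)) =
      - (\<Sum>j. d j * y ^ Suc j) - (- (\<Sum>j. d j * x ^ Suc j))"
    by (simp del: power_Suc)
  moreover have "ell_Gamma z \<tau> \<sigma> =
      exp (- (\<Sum>j. d j * y ^ Suc j)) / exp (- (\<Sum>j. d j * x ^ Suc j))"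
    using log x y
    by (simp add: ell_Gamma_eq[OF \<tau> \<sigma>] qrpoch_expi_def log_coeffs_def flip: x_def y_def)
  ultimately show ?thesis by (simp only: exp_diff)
qed

lemma ell_Gamma_summand_minus:
  "ell_Gamma_summand z \<tau> (- \<sigma>) j = ell_Gamma_summand (\<tau> - z) \<tau> \<sigma> j"
  "ell_Gamma_summand z (- \<tau>) \<sigma> j = ell_Gamma_summand (\<sigma> - z) \<tau> \<sigma> j"
  "ell_Gamma_summand z (- \<tau>) (- \<sigma>) j = ell_Gamma_summand (z + \<tau> + \<sigma>) \<tau> \<sigma> j"
proof -
  let ?c = "of_real pi * of_nat j :: complex"
  have "?c * (2 * (\<tau> - z) - \<tau> - \<sigma>) = - (?c * (2 * z - \<tau> + \<sigma>))"
    "?c * (2 * (\<sigma> - z) - \<tau> - \<sigma>) = - (?c * (2 * z + \<tau> - \<sigma>))"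
    by (simp_all add: algebra_simps)
  then show "ell_Gamma_summand z \<tau> (- \<sigma>) j = ell_Gamma_summand (\<tau> - z) \<tau> \<sigma> j"
    "ell_Gamma_summand z (- \<tau>) \<sigma> j = ell_Gamma_summand (\<sigma> - z) \<tau> \<sigma> j"
    unfolding ell_Gamma_summand_def by simp_all
  show "ell_Gamma_summand z (- \<tau>) (- \<sigma>) j = ell_Gamma_summand (z + \<tau> + \<sigma>) \<tau> \<sigma> j"
    unfolding ell_Gamma_summand_def by (simp add: algebra_simps)
qed

lemma ell_Gamma_sum:
  assumes "\<tau> \<notin> \<real>" "\<sigma> \<notin> \<real>"
    and "summable (\<lambda>j. norm (ell_Gamma_summand z \<tau> \<sigma> (Suc j)))"
  shows "ell_Gamma z \<tau> \<sigma> = exp (- (\<i> / 2) * (\<Sum>j. ell_Gamma_summand z \<tau> \<sigma> (Suc j)))"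
  using assms(1,2)
proof (cases rule: nonreal_pair_cases)
  case 1
  then show ?thesis using assms(3) by (rule ell_Gamma_sum_upper)
next
  case 2
  then show ?thesis using assms(3)
    by (simp only: ell_Gamma_minus_right ell_Gamma_summand_minus(1) ell_Gamma_sum_upper)
next
  case 3
  then show ?thesis using assms(3)
    by (simp only: ell_Gamma_minus_left ell_Gamma_summand_minus(2) ell_Gamma_sum_upper)
next
  case 4
  then show ?thesis using assms(3)
    by (simp only: ell_Gamma_minus_both ell_Gamma_summand_minus(3) ell_Gamma_sum_upper)
qed

theorem theorem3p3:
  shows
   "(\<forall>z \<tau> :: complex. \<tau> \<notin> \<real> \<longrightarrow>
       theta0 (z + 1) \<tau> = theta0 z \<tau> \<and>
       theta0 (z + \<tau>) \<tau> = - exp (- 2 * of_real pi * \<i> * z) * theta0 z \<tau> \<and>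
       theta0 (\<tau> - z) \<tau> = theta0 z \<tau>) \<and>
    (\<forall>z \<tau> \<sigma> :: complex. \<tau> \<notin> \<real> \<and> \<sigma> \<notin> \<real> \<longrightarrow>
       (ell_Gamma_defined z \<tau> \<sigma> \<and> ell_Gamma_defined z \<sigma> \<tau> \<longrightarrow>
          ell_Gamma z \<tau> \<sigma> = ell_Gamma z \<sigma> \<tau>) \<and>
       (ell_Gamma_defined (z + 1) \<tau> \<sigma> \<and> ell_Gamma_defined z \<tau> \<sigma> \<longrightarrow>
          ell_Gamma (z + 1) \<tau> \<sigma> = ell_Gamma z \<tau> \<sigma>) \<and>
       (ell_Gamma_defined (z + \<sigma>) \<tau> \<sigma> \<and> theta0_defined z \<tau> \<and> ell_Gamma_defined z \<tau> \<sigma> \<longrightarrow>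
          ell_Gamma (z + \<sigma>) \<tau> \<sigma> = theta0 z \<tau> * ell_Gamma z \<tau> \<sigma>) \<and>
       (ell_Gamma_defined (z + \<tau>) \<tau> \<sigma> \<and> theta0_defined z \<sigma> \<and> ell_Gamma_defined z \<tau> \<sigma> \<longrightarrow>
          ell_Gamma (z + \<tau>) \<tau> \<sigma> = theta0 z \<sigma> * ell_Gamma z \<tau> \<sigma>) \<and>
       ell_Gamma ((\<tau> + \<sigma>) / 2) \<tau> \<sigma> = 1 \<and>
       (ell_Gamma_defined z \<tau> \<sigma> \<and> ell_Gamma_defined (\<sigma> - z) \<tau> \<sigma> \<and> inverse_theta0_defined z \<sigma> \<longrightarrow>
          ell_Gamma z \<tau> \<sigma> * ell_Gamma (\<sigma> - z) \<tau> \<sigma> = 1 / theta0 z \<sigma>) \<and>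
       (ell_Gamma_defined z \<tau> \<sigma> \<and> ell_Gamma_defined (\<tau> - z) \<tau> \<sigma> \<and> inverse_theta0_defined z \<tau> \<longrightarrow>
          ell_Gamma z \<tau> \<sigma> * ell_Gamma (\<tau> - z) \<tau> \<sigma> = 1 / theta0 z \<tau>) \<and>
       (ell_Gamma_defined z \<tau> \<sigma> \<and> ell_Gamma_defined (\<tau> + \<sigma> - z) \<tau> \<sigma> \<longrightarrow>
          ell_Gamma z \<tau> \<sigma> * ell_Gamma (\<tau> + \<sigma> - z) \<tau> \<sigma> = 1) \<and>
       (summable (\<lambda>n. norm (ell_Gamma_summand z \<tau> \<sigma> (Suc n))) \<longrightarrow>
          ell_Gamma z \<tau> \<sigma> = exp (- (\<i> / 2) * (\<Sum>n. ell_Gamma_summand z \<tau> \<sigma> (Suc n)))))"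
proof (intro conjI allI impI; (elim conjE)?)
  fix z \<tau> :: complex
  assume nr: "\<tau> \<notin> \<real>"
  show "theta0 (z + 1) \<tau> = theta0 z \<tau>" by (rule theta0_shift_1)
  show "theta0 (z + \<tau>) \<tau> = - exp (- 2 * of_real pi * \<i> * z) * theta0 z \<tau>"
    using theta0_shift[OF nr, of z] by (simp add: expi_def)
  show "theta0 (\<tau> - z) \<tau> = theta0 z \<tau>" by (rule theta0_reflect)
next
  fix z \<tau> \<sigma> :: complex
  assume nr: "\<tau> \<notin> \<real>" "\<sigma> \<notin> \<real>"
  note commute = ell_Gamma_commute[OF nr]
  have defined_commute: "ell_Gamma_defined w \<sigma> \<tau> = ell_Gamma_defined w \<tau> \<sigma>" for w
    by (simp add: ell_Gamma_defined_def commute)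
  show "ell_Gamma z \<tau> \<sigma> = ell_Gamma z \<sigma> \<tau>" by (rule commute)
  show "ell_Gamma (z + 1) \<tau> \<sigma> = ell_Gamma z \<tau> \<sigma>"
    by (simp add: ell_Gamma_def expi_add)
  show "ell_Gamma ((\<tau> + \<sigma>) / 2) \<tau> \<sigma> = 1" by (rule ell_Gamma_midpoint[OF nr])
  {
    assume d: "ell_Gamma_defined z \<tau> \<sigma>"
    show "ell_Gamma (z + \<sigma>) \<tau> \<sigma> = theta0 z \<tau> * ell_Gamma z \<tau> \<sigma>"
      if "ell_Gamma_defined (z + \<sigma>) \<tau> \<sigma>" "theta0_defined z \<tau>"
      using ell_Gamma_shift[OF nr that d] .
    show "ell_Gamma (z + \<tau>) \<tau> \<sigma> = theta0 z \<sigma> * ell_Gamma z \<tau> \<sigma>"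
      if "ell_Gamma_defined (z + \<tau>) \<tau> \<sigma>" "theta0_defined z \<sigma>"
      using ell_Gamma_shift[OF nr(2,1), of z] that d by (simp add: defined_commute commute)
    show "ell_Gamma z \<tau> \<sigma> * ell_Gamma (\<sigma> - z) \<tau> \<sigma> = 1 / theta0 z \<sigma>"
      if "ell_Gamma_defined (\<sigma> - z) \<tau> \<sigma>"
      using ell_Gamma_reflect[OF nr d that] .
    show "ell_Gamma z \<tau> \<sigma> * ell_Gamma (\<tau> - z) \<tau> \<sigma> = 1 / theta0 z \<tau>"
      if "ell_Gamma_defined (\<tau> - z) \<tau> \<sigma>"
      using ell_Gamma_reflect[OF nr(2,1), of z] that d by (simp add: defined_commute commute)
    show "ell_Gamma z \<tau> \<sigma> * ell_Gamma (\<tau> + \<sigma> - z) \<tau> \<sigma> = 1"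
      if "ell_Gamma_defined (\<tau> + \<sigma> - z) \<tau> \<sigma>"
      using ell_Gamma_reflect_sum[OF nr d that] .
  }
  show "ell_Gamma z \<tau> \<sigma> = exp (- (\<i> / 2) * (\<Sum>n. ell_Gamma_summand z \<tau> \<sigma> (Suc n)))"
    if "summable (\<lambda>n. norm (ell_Gamma_summand z \<tau> \<sigma> (Suc n)))"
    using ell_Gamma_sum[OF nr that] .
qed

end
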